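(* Let $\Sigma$ be a finite alphabet with $|\Sigma|\ge 2$, let $\Sigma^*$ be the set of all words over $\Sigma$, and for each $n$ let $C_n=\{w\in\Sigma^* : C(w)\le n\}$, where $C(w)$ denotes the Kolmogorov complexity of $w$. If $X\subset\Sigma^*$ is an infinite decidable subset, then $$\liminf_{n\to\infty}\frac{|X\cap C_n|}{|C_n|}>0.$$ In other words, $X$ has positive lower asymptotic density with respect to the decomposition $\Sigma^*=\bigcup_n C_n$.
   Context: $|\cdot|$ applied to a set denotes cardinality; applied to a word it denotes length. Kolmogorov complexity is defined as follows. Fix a Turing complete programming language $\mathcal L$ over a finite alphabet $\Delta\supset\Sigma$, whose programs are used to compute functions from $\Sigma^*$ to $\Sigma^*$. (Turing complete, as usual, means that every partial computable function $\Sigma^*\to\Sigma^*$ is computed by some program, and running a given program on a given input is an effective process.) Programs are coded as words over $\Sigma$: each letter of $\Delta$ is coded by a distinct word of a fixed length $\ell$ over $\Sigma$, with $\ell$ large enough that there is an additional reserved word of length $\ell$, not coding any letter, which signals the end of a program. Thus a (coded) program is a word over $\Sigma$ consisting of blocks of length $\ell$ that code the letters of the original program, followed by the reserved block as a suffix. From here on "program" means coded program. A description of $w\in\Sigma^*$ is a word in $\Sigma^*$ of the form $pv$ where $p$ is a program, $v\in\Sigma^*$ is a word, and $p$ with input $v$ computes (halts with output) $w$. By the coding convention, an arbitrary word can be written as a description $pv$ in at most one way. The Kolmogorov complexity $C(w)$ is the length of a shortest description of $w$. The language $\mathcal L$ and the coding are fixed throughout. *)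

theory Defs
  imports Complex_Main "HOL-Library.Countable_Set" "HOL-Library.Extended_Real"
    "HOL-Library.Liminf_Limsup"
begin

(* Kleene's partial recursive functions. In "partial_recursive n f" only the values of f on
   lists of length n matter; composition and primitive recursion are strict in undefinedness. *)

inductive partial_recursive :: "nat \<Rightarrow> (nat list \<Rightarrow> nat option) \<Rightarrow> bool" where
  zero: "partial_recursive n (\<lambda>xs. Some 0)"
| succ: "partial_recursive 1 (\<lambda>xs. Some (Suc (hd xs)))"
| proj: "i < n \<Longrightarrow> partial_recursive n (\<lambda>xs. Some (xs ! i))"
| comp: "partial_recursive (length gs) f \<Longrightarrow> (\<forall>g\<in>set gs. partial_recursive n g) \<Longrightarrow>
    partial_recursive n (\<lambda>xs. Option.bind (those (map (\<lambda>g. g xs) gs)) f)"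
| prim_rec: "partial_recursive n f \<Longrightarrow> partial_recursive (Suc (Suc n)) g \<Longrightarrow>
    partial_recursive (Suc n) (\<lambda>xs.
      rec_nat (f (tl xs)) (\<lambda>m r. Option.bind r (\<lambda>y. g (m # y # tl xs))) (hd xs))"
| minimize: "partial_recursive (Suc n) f \<Longrightarrow>
    partial_recursive n (\<lambda>xs.
      if \<exists>m. f (m # xs) = Some 0 \<and> (\<forall>j<m. \<exists>y. f (j # xs) = Some (Suc y))
      then Some (LEAST m. f (m # xs) = Some 0) else None)"

(* Words over a finite alphabet A are identified with natural numbers by bijective numeration
   in base "card A", least significant letter first. The letters are numbered by to_nat_on A,
   a bijection from A onto {..<card A}. Another numbering of the letters would give the same
   computable functions and decidable sets: recoding letterwise is primitive recursive. *)

primrec word_code :: "'a set \<Rightarrow> 'a list \<Rightarrow> nat" where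
  "word_code A [] = 0"
| "word_code A (a # w) = Suc (to_nat_on A a) + card A * word_code A w"

lemma bij_betw_word_code:
  assumes "finite A" "A \<noteq> {}"
  shows "bij_betw (word_code A) (lists A) UNIV"
proof -
  have b: "bij_betw (to_nat_on A) A {..<card A}"
    using assms(1) by (rule to_nat_on_finite)
  have lt: "to_nat_on A a < card A" if "a \<in> A" for a
    using b that by (auto simp: bij_betw_def)
  have eq: "i = j \<and> x = y"
    if e: "i + card A * x = j + card A * y" and i: "i < card A" and j: "j < card A" for i j x y
  proof -
    have "(i + card A * x) mod card A = i" "(j + card A * y) mod card A = j"
      using i j by simp_all
    with e have "i = j" by simp
    with e i show ?thesis by simp
  qed
  have inj: "u = w" if "u \<in> lists A" "w \<in> lists A" "word_code A u = word_code A w" for u w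
    using that
  proof (induction u arbitrary: w rule: list.induct)
    case Nil
    then show ?case by (cases w) auto
  next
    case (Cons a u)
    from Cons.prems(3) obtain c v where w: "w = c # v" by (cases w) auto
    have A: "a \<in> A" "c \<in> A" "u \<in> lists A" "v \<in> lists A"
      using Cons.prems(1,2) w by simp_all
    have "to_nat_on A a = to_nat_on A c \<and> word_code A u = word_code A v"
      by (rule eq) (use Cons.prems(3) w A(1,2) lt in simp_all)
    moreover from this have "a = c"
      using A(1,2) b unfolding bij_betw_def by (blast dest: inj_onD)
    moreover from calculation have "u = v" using A(3,4) Cons.IH by blast
    ultimately show ?case using w by blast
  qed
  have surj: "\<exists>w\<in>lists A. word_code A w = n" for n
  proof (induction n rule: less_induct)
    case (less n)
    show ?case
    proof (cases n)
      case 0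
      then show ?thesis by (intro bexI[of _ "[]"]) auto
    next
      case (Suc m)
      have "m div card A < n" using Suc by (simp add: le_imp_less_Suc)
      with less obtain w where w: "w \<in> lists A" "word_code A w = m div card A" by blast
      have "m mod card A < card A" using assms by (simp add: card_gt_0_iff)
      then obtain a where a: "a \<in> A" "to_nat_on A a = m mod card A"
        using b by (metis bij_betw_iff_bijections lessThan_iff)
      show ?thesis by (intro bexI[of _ "a # w"]) (use w a Suc in auto)
    qed
  qed
  show ?thesis
    unfolding bij_betw_def inj_on_def using inj surj by (metis UNIV_eq_I imageI)
qed

definition partial_computable :: "'a set \<Rightarrow> ('a list \<Rightarrow> 'a list option) \<Rightarrow> bool" where
  "partial_computable A f \<longleftrightarrow>
     (\<forall>v\<in>lists A. \<forall>w. f v = Some w \<longrightarrow> w \<in> lists A) \<and>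
     (\<exists>g. partial_recursive 1 g \<and>
          (\<forall>v\<in>lists A. g [word_code A v] = map_option (word_code A) (f v)))"

definition decidable_words :: "'a set \<Rightarrow> 'a list set \<Rightarrow> bool" where
  "decidable_words A X \<longleftrightarrow>
     X \<subseteq> lists A \<and>
     (\<exists>g. partial_recursive 1 g \<and>
          (\<forall>w\<in>lists A. g [word_code A w] = Some (if w \<in> X then 1 else 0)))"

(* "run p v = Some w" means that the program p halts on the input v with output w. *)

locale turing_complete_language =
  fixes \<Sigma> \<Delta> :: "'a set"
    and Progs :: "'a list set"
    and run :: "'a list \<Rightarrow> 'a list \<Rightarrow> 'a list option"
  assumes finite_\<Delta>: "finite \<Delta>"
    and \<Sigma>_subset_\<Delta>: "\<Sigma> \<subseteq> \<Delta>"
    and Progs_subset: "Progs \<subseteq> lists \<Delta>"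
    and run_words: "\<lbrakk>p \<in> Progs; v \<in> lists \<Sigma>; run p v = Some w\<rbrakk> \<Longrightarrow> w \<in> lists \<Sigma>"
    and complete: "partial_computable \<Sigma> f \<Longrightarrow> \<exists>p\<in>Progs. \<forall>v\<in>lists \<Sigma>. run p v = f v"
    and effective: "\<exists>g. partial_recursive 2 g \<and>
      (\<forall>p\<in>Progs. \<forall>v\<in>lists \<Sigma>.
         g [word_code \<Delta> p, word_code \<Sigma> v] = map_option (word_code \<Sigma>) (run p v))"

locale coded_language = turing_complete_language \<Sigma> \<Delta> Progs run
  for \<Sigma> \<Delta> :: "'a set" and Progs run +
  fixes l :: nat
    and block :: "'a \<Rightarrow> 'a list"
    and end_block :: "'a list"
  assumes block_words: "d \<in> \<Delta> \<Longrightarrow> block d \<in> lists \<Sigma> \<and> length (block d) = l"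
    and inj_block: "inj_on block \<Delta>"
    and end_block_word: "end_block \<in> lists \<Sigma> \<and> length end_block = l"
    and end_block_reserved: "end_block \<notin> block ` \<Delta>"
begin

definition coded_program :: "'a list \<Rightarrow> 'a list" where
  "coded_program p = concat (map block p) @ end_block"

definition describes :: "'a list \<Rightarrow> 'a list \<Rightarrow> bool" where
  "describes d w \<longleftrightarrow>
     (\<exists>p\<in>Progs. \<exists>v\<in>lists \<Sigma>. d = coded_program p @ v \<and> run p v = Some w)"

(* Every word over the alphabet has a description, since constant functions are computable. *)

definition complexity :: "'a list \<Rightarrow> nat" where
  "complexity w = (LEAST n. \<exists>d. describes d w \<and> length d = n)"

definition complexity_le :: "nat \<Rightarrow> 'a list set" where
  "complexity_le n = {w \<in> lists \<Sigma>. complexity w \<le> n}"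

end

end

theory Submission
  imports Defs
begin

text \<open>
  Let \<open>k = card \<Sigma>\<close>. Both \<open>C n\<close> and \<open>X \<inter> C n\<close> have size \<open>k ^ n\<close> up to constant factors. From above, a
  word is determined by any of its descriptions, because a description splits into program and
  input in only one way; hence \<open>C n\<close> has at most as many elements as there are words of length at
  most \<open>n\<close>, and there are at most \<open>k ^ Suc n\<close> of these (lemmas
  \<open>coded_program_append_eq\<close> and \<open>card_complexity_le\<close>).

  From below, the decider of \<open>X\<close> and unbounded search yield a computable injection \<open>h\<close> of all words
  into \<open>X\<close>: under the numbering of words by \<^const>\<open>word_code\<close>, it sends the word with number \<open>i\<close> to the
  \<open>i\<close>-th element of \<open>X\<close> (lemma \<open>total_recursive_enumerate\<close>). Some program \<open>p\<close> computes \<open>h\<close>; let \<open>q\<close>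
  be its coded length. The \<open>k ^ (n - q)\<close> words \<open>v\<close> of length \<open>n - q\<close> give descriptions \<open>p v\<close> of length
  \<open>n\<close> of pairwise distinct elements of \<open>X\<close> (lemma \<open>ex_card_decidable_complexity_le\<close>). So the quotient is at least \<open>1 / k ^ Suc q\<close> for every
  \<open>n \<ge> q\<close>, and \<open>q\<close> does not depend on \<open>n\<close>.
\<close>

section \<open>Total recursive functions\<close>

text \<open>
  A function derived by the rules of \<^const>\<open>partial_recursive\<close> is fixed on argument lists of every
  length, whereas only those of length \<open>n\<close> are meaningful. Asking for agreement on these alone
  makes the notion extensional and rids the closure rules below of \<^typ>\<open>nat option\<close>.
\<close>

definition total_recursive :: "nat \<Rightarrow> (nat list \<Rightarrow> nat) \<Rightarrow> bool" where
  "total_recursive n F \<longleftrightarrow>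
     (\<exists>f. partial_recursive n f \<and> (\<forall>xs. length xs = n \<longrightarrow> f xs = Some (F xs)))"

lemma total_recursiveI:
  assumes "partial_recursive n f" "\<And>xs. length xs = n \<Longrightarrow> f xs = Some (F xs)"
  shows "total_recursive n F"
  using assms unfolding total_recursive_def by blast

lemma total_recursive_cong:
  assumes "total_recursive n F" "\<And>xs. length xs = n \<Longrightarrow> F xs = G xs"
  shows "total_recursive n G"
  using assms unfolding total_recursive_def by auto

lemma total_recursive_zero: "total_recursive n (\<lambda>xs. 0)"
  by (rule total_recursiveI[OF partial_recursive.zero]) simp

lemma total_recursive_proj: "i < n \<Longrightarrow> total_recursive n (\<lambda>xs. xs ! i)"
  by (rule total_recursiveI[OF partial_recursive.proj]) simp_all

lemma those_map_Some: "(\<And>x. x \<in> set xs \<Longrightarrow> f x = Some (g x)) \<Longrightarrow> those (map f xs) = Some (map g xs)"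
  by (induction xs) auto

lemma total_recursive_comp:
  assumes F: "total_recursive (length Gs) F" and Gs: "\<And>G. G \<in> set Gs \<Longrightarrow> total_recursive n G"
  shows "total_recursive n (\<lambda>xs. F (map (\<lambda>G. G xs) Gs))"
proof -
  obtain f where f: "partial_recursive (length Gs) f"
    "\<And>xs. length xs = length Gs \<Longrightarrow> f xs = Some (F xs)"
    using F unfolding total_recursive_def by blast
  have "\<forall>G\<in>set Gs. \<exists>g. partial_recursive n g \<and> (\<forall>xs. length xs = n \<longrightarrow> g xs = Some (G xs))"
    using Gs unfolding total_recursive_def by blast
  then obtain c where c: "\<And>G. G \<in> set Gs \<Longrightarrow> partial_recursive n (c G)"
    "\<And>G xs. G \<in> set Gs \<Longrightarrow> length xs = n \<Longrightarrow> c G xs = Some (G xs)"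
    by (auto dest!: bchoice)
  have "partial_recursive n (\<lambda>xs. Option.bind (those (map (\<lambda>g. g xs) (map c Gs))) f)"
    by (rule partial_recursive.comp) (use f(1) c(1) in auto)
  then show ?thesis
  proof (rule total_recursiveI)
    fix xs :: "nat list" assume "length xs = n"
    then have "those (map (\<lambda>G. c G xs) Gs) = Some (map (\<lambda>G. G xs) Gs)"
      by (intro those_map_Some) (rule c(2))
    then show "Option.bind (those (map (\<lambda>g. g xs) (map c Gs))) f = Some (F (map (\<lambda>G. G xs) Gs))"
      using f(2) by (simp add: comp_def)
  qed
qed

lemma total_recursive_comp1:
  assumes "total_recursive 1 F" "total_recursive n G"
  shows "total_recursive n (\<lambda>xs. F [G xs])"
  using total_recursive_comp[of "[G]" F n] assms by simp

lemma total_recursive_comp2: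
  assumes "total_recursive 2 F" "total_recursive n G" "total_recursive n H"
  shows "total_recursive n (\<lambda>xs. F [G xs, H xs])"
  using total_recursive_comp[of "[G, H]" F n] assms by (auto simp: numeral_2_eq_2)

lemma total_recursive_prim_rec:
  assumes "total_recursive n F" "total_recursive (Suc (Suc n)) G"
  shows "total_recursive (Suc n) (\<lambda>xs. rec_nat (F (tl xs)) (\<lambda>m y. G (m # y # tl xs)) (hd xs))"
proof -
  obtain f where f: "partial_recursive n f" "\<And>xs. length xs = n \<Longrightarrow> f xs = Some (F xs)"
    using assms(1) unfolding total_recursive_def by blast
  obtain g where g: "partial_recursive (Suc (Suc n)) g"
    "\<And>xs. length xs = Suc (Suc n) \<Longrightarrow> g xs = Some (G xs)"
    using assms(2) unfolding total_recursive_def by blast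
  show ?thesis
  proof (rule total_recursiveI[OF partial_recursive.prim_rec[OF f(1) g(1)]])
    fix xs :: "nat list" assume len: "length xs = Suc n"
    show "rec_nat (f (tl xs)) (\<lambda>m r. Option.bind r (\<lambda>y. g (m # y # tl xs))) (hd xs) =
        Some (rec_nat (F (tl xs)) (\<lambda>m y. G (m # y # tl xs)) (hd xs))"
      by (induction ("hd xs")) (use len f(2) g(2) in simp_all)
  qed
qed

lemma total_recursive_Least:
  assumes "total_recursive (Suc n) F" and ex: "\<And>xs. length xs = n \<Longrightarrow> \<exists>m. F (m # xs) = 0"
  shows "total_recursive n (\<lambda>xs. LEAST m. F (m # xs) = 0)"
proof -
  obtain f where f: "partial_recursive (Suc n) f" "\<And>xs. length xs = Suc n \<Longrightarrow> f xs = Some (F xs)"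
    using assms(1) unfolding total_recursive_def by blast
  show ?thesis
  proof (rule total_recursiveI[OF partial_recursive.minimize[OF f(1)]])
    fix xs :: "nat list" assume len: "length xs = n"
    have eq: "f (m # xs) = Some (F (m # xs))" for m using len f(2) by simp
    define m where "m = (LEAST m. F (m # xs) = 0)"
    have "F (m # xs) = 0" unfolding m_def using ex[OF len] by (rule LeastI_ex)
    moreover have "F (j # xs) \<noteq> 0" if "j < m" for j
      using that unfolding m_def by (rule not_less_Least)
    ultimately have "\<exists>m. f (m # xs) = Some 0 \<and> (\<forall>j<m. \<exists>y. f (j # xs) = Some (Suc y))"
      unfolding eq by (metis not0_implies_Suc)
    then show "(if \<exists>m. f (m # xs) = Some 0 \<and> (\<forall>j<m. \<exists>y. f (j # xs) = Some (Suc y))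
        then Some (LEAST m. f (m # xs) = Some 0) else None) = Some (LEAST m. F (m # xs) = 0)"
      by (simp add: eq)
  qed
qed

lemma total_recursive_Suc:
  assumes "total_recursive n F"
  shows "total_recursive n (\<lambda>xs. Suc (F xs))"
proof -
  have "total_recursive 1 (\<lambda>xs. Suc (hd xs))"
    by (rule total_recursiveI[OF partial_recursive.succ]) simp
  from total_recursive_comp1[OF this assms] show ?thesis by simp
qed

lemma total_recursive_const: "total_recursive n (\<lambda>xs. c)"
  by (induction c) (auto intro: total_recursive_zero total_recursive_Suc)

lemma total_recursive_add:
  assumes "total_recursive n F" "total_recursive n G"
  shows "total_recursive n (\<lambda>xs. F xs + G xs)"
proof -
  have rec: "rec_nat b (\<lambda>_ y. Suc y) a = a + b" for a b :: nat
    by (induction a) auto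
  have "total_recursive (Suc 1)
      (\<lambda>xs. rec_nat (tl xs ! 0) (\<lambda>m y. Suc ((m # y # tl xs) ! 1)) (hd xs))"
    by (intro total_recursive_prim_rec total_recursive_Suc total_recursive_proj) simp_all
  then have "total_recursive 2 (\<lambda>xs. hd xs + tl xs ! 0)"
    by (simp add: rec numeral_2_eq_2)
  from total_recursive_comp2[OF this assms] show ?thesis by simp
qed

text \<open>The \<open>0\<close>-\<open>1\<close> complement: it turns a characteristic function into one that vanishes exactly on the
  set, as minimization requires.\<close>

lemma total_recursive_one_minus:
  assumes "total_recursive n F"
  shows "total_recursive n (\<lambda>xs. 1 - F xs)"
proof -
  have rec: "rec_nat (Suc 0) (\<lambda>_ _. 0) a = 1 - a" for a :: nat
    by (cases a) auto
  have "total_recursive (Suc 0) (\<lambda>xs. rec_nat (Suc 0) (\<lambda>m y. 0) (hd xs))"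
    by (intro total_recursive_prim_rec total_recursive_const)
  then have "total_recursive 1 (\<lambda>xs. 1 - hd xs)"
    by (simp add: rec)
  from total_recursive_comp1[OF this assms] show ?thesis by simp
qed

text \<open>
  The next element of \<open>S\<close> after \<open>y\<close> is \<open>Suc (y + m)\<close> for the least \<open>m\<close> that puts it into \<open>S\<close>; infinity
  of \<open>S\<close> makes this search total. The enumeration iterates it by primitive recursion.
\<close>

lemma total_recursive_enumerate:
  assumes S: "infinite S" and dec: "total_recursive 1 (\<lambda>xs. if hd xs \<in> S then 1 else 0)"
  shows "total_recursive 1 (\<lambda>xs. enumerate S (hd xs))"
proof -
  define D where "D = (\<lambda>x. 1 - (if x \<in> S then 1 else 0 :: nat))"
  have D0: "D x = 0 \<longleftrightarrow> x \<in> S" for x by (simp add: D_def)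
  have D: "total_recursive 1 (\<lambda>xs. D (hd xs))"
    unfolding D_def by (rule total_recursive_one_minus[OF dec])
  have ex: "\<exists>m. Suc (y + m) \<in> S" for y
  proof -
    obtain s where "s > y" "s \<in> S" using S by (metis infinite_nat_iff_unbounded)
    then show ?thesis by (metis less_iff_Suc_add)
  qed
  define N where "N y = Suc (y + (LEAST m. Suc (y + m) \<in> S))" for y
  have N: "N y = (LEAST s. s \<in> S \<and> y < s)" for y
  proof (rule Least_equality[symmetric])
    show "N y \<in> S \<and> y < N y"
      unfolding N_def using LeastI_ex[OF ex[of y]] by simp
    fix s assume "s \<in> S \<and> y < s"
    then show "N y \<le> s"
      unfolding N_def by (auto simp: less_iff_Suc_add intro: Least_le)
  qed
  have rec: "rec_nat (enumerate S 0) (\<lambda>m y. N y) a = enumerate S a" for a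
    by (induction a) (simp_all add: N enumerate_Suc'' S)
  \<comment> \<open>In the search the argument list is the candidate \<open>m\<close>, the recursion counter, and \<open>y\<close>.\<close>
  have "total_recursive (Suc 2) (\<lambda>xs. D (hd [Suc (xs ! 2 + xs ! 0)]))"
    by (intro total_recursive_comp1[OF D] total_recursive_Suc total_recursive_add
        total_recursive_proj) simp_all
  then have "total_recursive 2 (\<lambda>xs. LEAST m. D (hd [Suc ((m # xs) ! 2 + (m # xs) ! 0)]) = 0)"
    by (rule total_recursive_Least) (use ex in \<open>simp add: D0\<close>)
  then have "total_recursive 2 (\<lambda>xs. LEAST m. Suc (xs ! 1 + m) \<in> S)"
    by (simp add: D0)
  then have "total_recursive 2 (\<lambda>xs. N (xs ! 1))"
    unfolding N_def by (intro total_recursive_Suc total_recursive_add total_recursive_proj) simp_all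
  then have "total_recursive (Suc 0)
      (\<lambda>xs. rec_nat (enumerate S 0) (\<lambda>m y. N ((m # y # tl xs) ! 1)) (hd xs))"
    by (intro total_recursive_prim_rec total_recursive_const) (simp add: numeral_2_eq_2)
  then show ?thesis by (simp add: rec)
qed

section \<open>A computable injection into an infinite decidable set\<close>

lemma partial_computable_via_code:
  assumes "finite A" "A \<noteq> {}" "total_recursive 1 (\<lambda>xs. F (hd xs))"
    and "\<And>v. v \<in> lists A \<Longrightarrow> h v \<in> lists A \<and> word_code A (h v) = F (word_code A v)"
  shows "partial_computable A (\<lambda>v. Some (h v))"
proof -
  obtain f where "partial_recursive 1 f" "\<And>xs. length xs = 1 \<Longrightarrow> f xs = Some (F (hd xs))"
    using assms(3) unfolding total_recursive_def by blast
  then show ?thesis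
    unfolding partial_computable_def using assms(4) by auto
qed

lemma ex_computable_injection_into_decidable:
  assumes A: "finite A" "A \<noteq> {}" and X: "infinite X" "decidable_words A X"
  obtains h where "partial_computable A (\<lambda>v. Some (h v))" "inj_on h (lists A)"
    "h ` lists A \<subseteq> X"
proof -
  let ?c = "word_code A"
  have XA: "X \<subseteq> lists A" using X(2) unfolding decidable_words_def by blast
  obtain g where g: "partial_recursive 1 g"
    "\<And>w. w \<in> lists A \<Longrightarrow> g [?c w] = Some (if w \<in> X then 1 else 0)"
    using X(2) unfolding decidable_words_def by blast
  have bij: "bij_betw ?c (lists A) UNIV" by (rule bij_betw_word_code[OF A])
  then have inj: "inj_on ?c (lists A)" by (rule bij_betw_imp_inj_on)
  define S where "S = ?c ` X"
  have S: "infinite S"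
    unfolding S_def using X(1) inj_on_subset[OF inj XA] by (simp add: finite_image_iff)
  have gS: "g [x] = Some (if x \<in> S then 1 else 0)" for x
  proof -
    obtain w where w: "w \<in> lists A" "x = ?c w"
      using bij unfolding bij_betw_def by (metis UNIV_I imageE)
    then have "x \<in> S \<longleftrightarrow> w \<in> X"
      unfolding S_def using inj XA by (auto dest: inj_onD)
    then show ?thesis using g(2)[OF w(1)] w(2) by simp
  qed
  have "total_recursive 1 (\<lambda>xs. if hd xs \<in> S then 1 else 0)"
    using g(1)
  proof (rule total_recursiveI)
    fix xs :: "nat list" assume "length xs = 1"
    then obtain x where "xs = [x]" by (auto simp: length_Suc_conv)
    then show "g xs = Some (if hd xs \<in> S then 1 else 0)" by (simp add: gS)
  qed
  then have rec: "total_recursive 1 (\<lambda>xs. enumerate S (hd xs))"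
    by (rule total_recursive_enumerate[OF S])
  define h where "h v = inv_into X ?c (enumerate S (?c v))" for v
  have mem: "enumerate S i \<in> ?c ` X" for i
    using enumerate_in_set[OF S] unfolding S_def by blast
  have hX: "h v \<in> X" and hc: "?c (h v) = enumerate S (?c v)" for v
    unfolding h_def using mem by (rule inv_into_into, rule f_inv_into_f)
  show thesis
  proof
    show "partial_computable A (\<lambda>v. Some (h v))"
      using hX hc XA by (intro partial_computable_via_code[OF A rec]) blast
    show "inj_on h (lists A)"
    proof (rule inj_onI)
      fix u v assume uv: "u \<in> lists A" "v \<in> lists A" "h u = h v"
      then have "enumerate S (?c u) = enumerate S (?c v)" by (metis hc)
      then have "?c u = ?c v"
        using strict_mono_enumerate[OF S] by (simp add: strict_mono_eq)
      then show "u = v" using inj uv by (auto dest: inj_onD)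
    qed
    show "h ` lists A \<subseteq> X" using hX by blast
  qed
qed

section \<open>Descriptions\<close>

lemma card_lists_le:
  assumes "finite A" "card A \<ge> 2"
  shows "card {v \<in> lists A. length v \<le> n} \<le> card A ^ Suc n"
proof -
  have "(\<Sum>i\<le>n. card A ^ i) \<le> card A ^ Suc n"
  proof (induction n)
    case (Suc n)
    then have "(\<Sum>i\<le>Suc n. card A ^ i) \<le> 2 * card A ^ Suc n" by simp
    also have "\<dots> \<le> card A * card A ^ Suc n" using assms(2) by (rule mult_le_mono1)
    finally show ?case by simp
  qed (use assms(2) in simp)
  then show ?thesis
    using card_lists_length_le[OF assms(1), of n] by (simp add: lists_eq_set)
qed

context coded_language
begin

text \<open>Since all blocks have the same length, cutting a word into blocks is deterministic, and the
  first of these equal to the reserved block shows where the program ends.\<close>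

lemma coded_program_append_eq:
  assumes "p \<in> lists \<Delta>" "q \<in> lists \<Delta>" "coded_program p @ u = coded_program q @ v"
  shows "p = q \<and> u = v"
  using assms
proof (induction p arbitrary: q rule: list.induct)
  case Nil
  show ?case
  proof (cases q)
    case Nil
    then show ?thesis using \<open>coded_program [] @ u = _\<close> by (simp add: coded_program_def)
  next
    case (Cons b q')
    then have "end_block = block b"
      using \<open>q \<in> lists \<Delta>\<close> \<open>coded_program [] @ u = _\<close> block_words[of b] end_block_word
      by (simp add: coded_program_def)
    then show ?thesis using end_block_reserved Cons \<open>q \<in> lists \<Delta>\<close> by auto
  qed
next
  case (Cons a p)
  show ?case
  proof (cases q)
    case Nil
    then have "end_block = block a"
      using Cons.prems block_words[of a] end_block_word by (simp add: coded_program_def)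
    then show ?thesis using end_block_reserved Cons.prems(1) by auto
  next
    case (Cons b q')
    with Cons.prems have ab: "a \<in> \<Delta>" "b \<in> \<Delta>" "p \<in> lists \<Delta>" "q' \<in> lists \<Delta>" by auto
    have "block a @ (coded_program p @ u) = block b @ (coded_program q' @ v)"
      using Cons.prems(3) Cons by (simp add: coded_program_def)
    then have "block a = block b" "coded_program p @ u = coded_program q' @ v"
      using block_words ab by simp_all
    then show ?thesis using Cons.IH ab inj_block Cons by (auto dest: inj_onD)
  qed
qed

lemma describes_unique: "describes d w \<Longrightarrow> describes d w' \<Longrightarrow> w = w'"
  unfolding describes_def using coded_program_append_eq Progs_subset
  by (metis option.inject subsetD)

lemma describes_words:
  assumes "describes d w"
  shows "d \<in> lists \<Sigma>"
proof -
  obtain p v where p: "p \<in> Progs" "v \<in> lists \<Sigma>" "d = coded_program p @ v"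
    using assms unfolding describes_def by blast
  have "concat (map block p) \<in> lists \<Sigma>" if "p \<in> lists \<Delta>" for p
    using that by (induction p) (use block_words in auto)
  then show ?thesis
    using p Progs_subset end_block_word by (auto simp: coded_program_def)
qed

text \<open>The complexity is a least number, so it means something only for words that have a
  description; a program for the identity provides one for every word.\<close>

lemma ex_describes:
  assumes "\<Sigma> \<noteq> {}" "w \<in> lists \<Sigma>"
  shows "\<exists>d. describes d w"
proof -
  have "finite \<Sigma>" using finite_\<Delta> \<Sigma>_subset_\<Delta> by (rule rev_finite_subset)
  moreover have "total_recursive 1 (\<lambda>xs. hd xs)"
    using total_recursive_proj[of 0 1]
    by (rule total_recursive_cong) (auto simp: length_Suc_conv)
  ultimately have "partial_computable \<Sigma> (\<lambda>v. Some v)"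
    using assms(1) by (intro partial_computable_via_code[where F = "\<lambda>x. x"]) auto
  then obtain p where "p \<in> Progs" "run p w = Some w"
    using complete assms(2) by metis
  then show ?thesis unfolding describes_def using assms(2) by blast
qed

lemma complexity_le_subset_described:
  assumes "\<Sigma> \<noteq> {}"
  shows "complexity_le n \<subseteq> (\<lambda>d. THE w. describes d w) ` {v \<in> lists \<Sigma>. length v \<le> n}"
proof
  fix w assume w: "w \<in> complexity_le n"
  then have "\<exists>m d. describes d w \<and> length d = m"
    using ex_describes[OF assms] by (auto simp: complexity_le_def)
  then have "\<exists>d. describes d w \<and> length d = complexity w"
    unfolding complexity_def by (rule LeastI_ex)
  then obtain d where d: "describes d w" "length d \<le> n"
    using w by (auto simp: complexity_le_def)
  then have "(THE w. describes d w) = w" using describes_unique by blast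
  with d show "w \<in> (\<lambda>d. THE w. describes d w) ` {v \<in> lists \<Sigma>. length v \<le> n}"
    using describes_words by blast
qed

lemma card_complexity_le:
  assumes "card \<Sigma> \<ge> 2"
  shows "finite (complexity_le n)" "card (complexity_le n) \<le> card \<Sigma> ^ Suc n"
proof -
  have \<Sigma>: "finite \<Sigma>" using finite_\<Delta> \<Sigma>_subset_\<Delta> by (rule rev_finite_subset)
  have ne: "\<Sigma> \<noteq> {}" using assms by auto
  have fin: "finite {v \<in> lists \<Sigma>. length v \<le> n}"
    using finite_lists_length_le[OF \<Sigma>] by (simp add: lists_eq_set)
  note sub = complexity_le_subset_described[OF ne, of n]
  show "finite (complexity_le n)" using sub fin by (meson finite_imageI finite_subset)
  show "card (complexity_le n) \<le> card \<Sigma> ^ Suc n"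
    using surj_card_le[OF fin sub] card_lists_le[OF \<Sigma> assms] by (rule le_trans)
qed

lemma describes_imp_mem_complexity_le:
  assumes "describes d w" "length d \<le> n"
  shows "w \<in> complexity_le n"
proof -
  have "complexity w \<le> length d"
    unfolding complexity_def by (rule Least_le) (use assms(1) in blast)
  then show ?thesis
    using assms run_words unfolding complexity_le_def describes_def by auto
qed

text \<open>Prefixing a program of coded length \<open>q\<close> lengthens every input by the same \<open>q\<close>: an infinite
  decidable set loses only the constant factor \<open>card \<Sigma> ^ q\<close> against all words.\<close>

lemma ex_card_decidable_complexity_le:
  assumes "card \<Sigma> \<ge> 2" "infinite X" "decidable_words \<Sigma> X"
  obtains q where "\<And>n. n \<ge> q \<Longrightarrow> card \<Sigma> ^ (n - q) \<le> card (X \<inter> complexity_le n)"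
proof -
  have \<Sigma>: "finite \<Sigma>" using finite_\<Delta> \<Sigma>_subset_\<Delta> by (rule rev_finite_subset)
  have ne: "\<Sigma> \<noteq> {}" using assms by auto
  obtain h where h: "partial_computable \<Sigma> (\<lambda>v. Some (h v))" "inj_on h (lists \<Sigma>)"
    "h ` lists \<Sigma> \<subseteq> X"
    by (rule ex_computable_injection_into_decidable[OF \<Sigma> ne assms(2,3)])
  obtain p where p: "p \<in> Progs" "\<And>v. v \<in> lists \<Sigma> \<Longrightarrow> run p v = Some (h v)"
    using complete[OF h(1)] by blast
  show thesis
  proof
    fix n assume n: "length (coded_program p) \<le> n"
    let ?V = "{v \<in> lists \<Sigma>. length v = n - length (coded_program p)}"
    have "h ` ?V \<subseteq> X \<inter> complexity_le n"
    proof (intro image_subsetI IntI)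
      fix v assume v: "v \<in> ?V"
      then show "h v \<in> X" using h(3) by blast
      have "describes (coded_program p @ v) (h v)"
        unfolding describes_def using p v by blast
      then show "h v \<in> complexity_le n"
        by (rule describes_imp_mem_complexity_le) (use v n in simp)
    qed
    moreover have "inj_on h ?V" using h(2) by (rule inj_on_subset) blast
    ultimately have "card ?V \<le> card (X \<inter> complexity_le n)"
      using card_complexity_le(1)[OF assms(1)] by (metis card_inj_on_le finite_Int)
    then show "card \<Sigma> ^ (n - length (coded_program p)) \<le> card (X \<inter> complexity_le n)"
      using card_lists_length_eq[OF \<Sigma>] by (simp add: lists_eq_set)
  qed
qed

end

theorem theorem1:
  fixes \<Sigma> \<Delta> :: "'a set"
    and Progs :: "'a list set"
    and run :: "'a list \<Rightarrow> 'a list \<Rightarrow> 'a list option"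
    and l :: nat
    and block :: "'a \<Rightarrow> 'a list"
    and end_block :: "'a list"
    and X :: "'a list set"
  defines "C \<equiv> coded_language.complexity_le \<Sigma> Progs run block end_block"
  assumes "finite \<Sigma>" and "card \<Sigma> \<ge> 2"
    and "coded_language \<Sigma> \<Delta> Progs run l block end_block"
    and "X \<subseteq> lists \<Sigma>" and "infinite X" and "decidable_words \<Sigma> X"
  shows "liminf (\<lambda>n. ereal (real (card (X \<inter> C n)) / real (card (C n)))) > 0"
proof -
  interpret coded_language \<Sigma> \<Delta> Progs run l block end_block by fact
  let ?k = "real (card \<Sigma>)"
  note k = \<open>card \<Sigma> \<ge> 2\<close>
  obtain q where q: "\<And>n. n \<ge> q \<Longrightarrow> card \<Sigma> ^ (n - q) \<le> card (X \<inter> C n)"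
    using ex_card_decidable_complexity_le[OF k \<open>infinite X\<close> \<open>decidable_words \<Sigma> X\<close>]
    unfolding C_def by blast
  have bound: "1 / ?k ^ Suc q \<le> real (card (X \<inter> C n)) / real (card (C n))" if n: "n \<ge> q" for n
  proof -
    have "0 < card \<Sigma> ^ (n - q)" using k by simp
    then have "0 < card (X \<inter> C n)" using q[OF n] by linarith
    then have pos: "0 < card (C n)"
      using card_complexity_le(1)[OF k, of n] unfolding C_def by (auto simp: card_gt_0_iff)
    have le: "real (card (C n)) \<le> ?k ^ Suc n"
      using card_complexity_le(2)[OF k, of n] unfolding C_def
      by (metis of_nat_le_iff of_nat_power)
    have "?k ^ Suc n = ?k ^ Suc q * ?k ^ (n - q)"
      using n by (simp flip: power_add)
    then have "1 / ?k ^ Suc q = ?k ^ (n - q) / ?k ^ Suc n" using k by (simp add: field_simps)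
    also have "\<dots> \<le> real (card (X \<inter> C n)) / ?k ^ Suc n"
      using q[OF n] by (intro divide_right_mono) (simp_all flip: of_nat_power)
    also have "\<dots> \<le> real (card (X \<inter> C n)) / real (card (C n))"
      using le pos k by (intro divide_left_mono) simp_all
    finally show ?thesis .
  qed
  have "0 < ereal (1 / ?k ^ Suc q)" using k by simp
  also have "\<dots> \<le> liminf (\<lambda>n. ereal (real (card (X \<inter> C n)) / real (card (C n))))"
    by (rule Liminf_bounded) (use bound in \<open>auto simp: eventually_sequentially\<close>)
  finally show ?thesis .
qed

end
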